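(* If $n\geq 3$ is an integer, then $\#\mathcal V_n^+(\mathbb Z)\geq f_n$.
   Context: $f_n$ denotes the Fibonacci sequence: $f_0=0$, $f_1=1$, $f_n=f_{n-1}+f_{n-2}$ for $n\geq 2$. $A_n$ is the $2\times n$ matrix with first row $(f_1,\ldots,f_n)$ and second row $(f_0,\ldots,f_{n-1})$; $\mathcal V_n^+(\mathbb Z)$ is the set of ${\bf x}\in\mathbb Z^n$ with all entries non-negative and $A_n{\bf x}=(f_n,f_{n-1})^T$. *)

theory Defs
  imports "HOL-Number_Theory.Fib" "Jordan_Normal_Form.Matrix"
begin

text \<open>Rows and columns are indexed from 0, so column \<open>j\<close> here is the column \<open>j + 1\<close> of
  the matrix with columns \<open>(f_1, f_0), ..., (f_n, f_(n-1))\<close>.\<close>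

definition fib_mat :: "nat \<Rightarrow> int mat" where
  "fib_mat n = mat 2 n (\<lambda>(i, j). if i = 0 then int (fib (j + 1)) else int (fib j))"

definition fib_vpart :: "nat \<Rightarrow> int vec set" where
  "fib_vpart n = {x \<in> carrier_vec n. (\<forall>i<n. 0 \<le> x $ i) \<and>
     fib_mat n *\<^sub>v x = vec_of_list [int (fib n), int (fib (n - 1))]}"

end

theory Submission imports Defs begin

text \<open>
  Write \<open>v_j = (f_j, f_(j-1))\<close>, so that \<open>fib_vpart n\<close> consists of the partitions of \<open>v_n\<close>
  into parts \<open>v_1, ..., v_n\<close>. Raising all indices by one turns the partitions of \<open>v_(n-1)\<close> into
  the partitions of \<open>v_n\<close> without the part \<open>v_1\<close>. On the other hand, for each \<open>k < f_(n-2)\<close> there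
  is a partition of \<open>v_n\<close> in which \<open>v_1\<close> occurs \<open>f_(n-2) - k > 0\<close> times: the multiplicities of
  \<open>v_3, ..., v_n\<close> are the Zeckendorf digits of \<open>k\<close>, and \<open>v_2\<close> makes up the difference. Hence
  the number of partitions of \<open>v_n\<close> is at least that of \<open>v_(n-1)\<close> plus \<open>f_(n-2)\<close>.
\<close>

lemma fib_vpart_iff:
  "x \<in> fib_vpart n \<longleftrightarrow>
     dim_vec x = n \<and> (\<forall>i<n. 0 \<le> x $ i) \<and>
     (\<Sum>j<n. int (fib (Suc j)) * x $ j) = int (fib n) \<and>
     (\<Sum>j<n. int (fib j) * x $ j) = int (fib (n - 1))"
proof -
  have "fib_mat n *\<^sub>v x = vec_of_list [int (fib n), int (fib (n - 1))] \<longleftrightarrow>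
      (\<Sum>j<n. int (fib (Suc j)) * x $ j) = int (fib n) \<and>
      (\<Sum>j<n. int (fib j) * x $ j) = int (fib (n - 1))" if "dim_vec x = n"
    using that
    by (auto simp: fib_mat_def vec_eq_iff scalar_prod_def less_Suc_eq numeral_2_eq_2
        lessThan_atLeast0)
  then show ?thesis
    unfolding fib_vpart_def carrier_vec_def by blast
qed

text \<open>In the first-row equation all terms are nonnegative and all coefficients are at least 1,
  so each entry is at most \<open>fib n\<close>. Finiteness matters because \<open>card\<close> of
  an infinite set is 0.\<close>

lemma finite_fib_vpart: "finite (fib_vpart n)"
proof (rule finite_subset)
  show "fib_vpart n \<subseteq> vec_of_list ` {xs. set xs \<subseteq> {0..int (fib n)} \<and> length xs = n}"
  proof
    fix x assume x: "x \<in> fib_vpart n"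
    have "x $ i \<le> int (fib n)" if i: "i < n" for i
    proof -
      have "x $ i * 1 \<le> x $ i * int (fib (Suc i))"
        using x i by (intro mult_left_mono) (auto simp: fib_vpart_iff fib_neq_0_nat Suc_le_eq)
      also have "\<dots> = int (fib (Suc i)) * x $ i" by simp
      also have "\<dots> \<le> (\<Sum>j<n. int (fib (Suc j)) * x $ j)"
        using x i by (intro member_le_sum) (auto simp: fib_vpart_iff)
      also have "\<dots> = int (fib n)" using x by (simp add: fib_vpart_iff)
      finally show ?thesis by simp
    qed
    then have "list_of_vec x \<in> {xs. set xs \<subseteq> {0..int (fib n)} \<and> length xs = n}"
      using x by (auto simp: fib_vpart_iff in_set_conv_nth list_of_vec_index)
    then show "x \<in> vec_of_list ` {xs. set xs \<subseteq> {0..int (fib n)} \<and> length xs = n}"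
      by (metis image_eqI vec_list)
  qed
qed (intro finite_imageI finite_lists_length_eq, simp)

text \<open>By the Fibonacci recurrence the new first-row equation is the sum of the two old ones;
  the new second-row equation is the old first one.\<close>

lemma vCons_0_in_fib_vpart:
  assumes "x \<in> fib_vpart (Suc m)"
  shows "vCons 0 x \<in> fib_vpart (Suc (Suc m))"
proof -
  have "(\<Sum>j<Suc m. int (fib (Suc (Suc j))) * x $ j) =
      (\<Sum>j<Suc m. int (fib (Suc j)) * x $ j) + (\<Sum>j<Suc m. int (fib j) * x $ j)"
    by (simp only: fib.simps of_nat_add distrib_right sum.distrib)
  with assms show ?thesis
    unfolding fib_vpart_iff
    by (subst (1 2) sum.lessThan_Suc_shift) (auto simp: less_Suc_eq_0_disj simp del: sum.lessThan_Suc)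
qed

text \<open>The digits \<open>z\<close> are chosen greedily. The bound on the sum with raised
  indices later keeps the multiplicity of \<open>v_2\<close> nonnegative.\<close>

lemma zeckendorf_shift:
  assumes "k < fib m"
  shows "\<exists>z :: nat \<Rightarrow> nat. (\<Sum>i<m. fib (Suc i) * z i) = k \<and>
    (\<Sum>i<m. fib (Suc (Suc i)) * z i) < fib (Suc m)"
  using assms
proof (induction m arbitrary: k rule: fib.induct)
  case 1
  then show ?case by simp
next
  case 2
  then show ?case by (intro exI[of _ "\<lambda>_. 0"]) simp
next
  case (3 m)
  show ?case
  proof (cases "k < fib (Suc m)")
    case True
    from "3.IH"(1)[OF True] obtain z where
      z: "(\<Sum>i<Suc m. fib (Suc i) * z i) = k"
        "(\<Sum>i<Suc m. fib (Suc (Suc i)) * z i) < fib (Suc (Suc m))"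
      by blast
    \<comment> \<open>The induction hypothesis says nothing about \<open>z (Suc m)\<close>, so this
      digit is reset to 0.\<close>
    have "(\<Sum>i<Suc m. g i * (z(Suc m := 0)) i) = (\<Sum>i<Suc m. g i * z i)" for g :: "nat \<Rightarrow> nat"
      by (intro sum.cong) auto
    with z show ?thesis
      by (intro exI[of _ "z(Suc m := 0)"])
        (simp add: sum.lessThan_Suc[of _ "Suc m"] del: sum.lessThan_Suc)
  next
    case False
    \<comment> \<open>Digit \<open>m\<close>, of weight \<open>fib (Suc m)\<close>, becomes 1. The
      raised sum then grows by \<open>fib (Suc (Suc m))\<close> and stays below
      \<open>fib (Suc (Suc (Suc m)))\<close>.\<close>
    then have "k - fib (Suc m) < fib m" using "3.prems" by simp
    from "3.IH"(2)[OF this] obtain z where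
      z: "(\<Sum>i<m. fib (Suc i) * z i) = k - fib (Suc m)"
        "(\<Sum>i<m. fib (Suc (Suc i)) * z i) < fib (Suc m)"
      by blast
    have "(\<Sum>i<m. g i * (z(m := 1, Suc m := 0)) i) = (\<Sum>i<m. g i * z i)" for g :: "nat \<Rightarrow> nat"
      by (intro sum.cong) auto
    with z False show ?thesis
      by (intro exI[of _ "z(m := 1, Suc m := 0)"]) simp
  qed
qed

lemma fib_vpart_head_exists:
  assumes "k < fib m"
  shows "\<exists>x \<in> fib_vpart (Suc (Suc m)). x $ 0 = int (fib m - k)"
proof -
  from zeckendorf_shift[OF assms] obtain z :: "nat \<Rightarrow> nat" where
    z: "(\<Sum>i<m. fib (Suc i) * z i) = k"
      "(\<Sum>i<m. fib (Suc (Suc i)) * z i) < fib (Suc m)"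
    by blast
  define s where "s = (\<Sum>i<m. fib (Suc (Suc i)) * z i)"
  \<comment> \<open>Given the entries \<open>z i\<close>, the second row forces the entry
    \<open>fib (Suc m) - s\<close>, and the first row then forces \<open>fib m - k\<close>. Both
    natural-number differences are positive, hence not truncated.\<close>
  define x where "x = vCons (int (fib m - k)) (vCons (int (fib (Suc m) - s)) (vec m (\<lambda>i. int (z i))))"
  have sum_k: "(\<Sum>i<m. int (fib (Suc i)) * int (z i)) = int k"
    unfolding z(1)[symmetric] by simp
  have sum_s: "(\<Sum>i<m. int (fib (Suc (Suc i))) * int (z i)) = int s"
    unfolding s_def by (simp del: fib.simps)
  have sum_ks: "(\<Sum>i<m. int (fib (Suc (Suc (Suc i)))) * int (z i)) = int s + int k"
    unfolding sum_k[symmetric] sum_s[symmetric] fib.simps(3)[of "Suc i" for i]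
    by (simp only: of_nat_add distrib_right sum.distrib)
  have "x \<in> fib_vpart (Suc (Suc m))"
    unfolding fib_vpart_iff sum.lessThan_Suc_shift x_def
    using assms z(2)[folded s_def] sum_s sum_ks
    by (auto simp: less_Suc_eq_0_disj of_nat_diff simp del: fib.simps(3))
      (simp_all add: of_nat_diff)
  moreover have "x $ 0 = int (fib m - k)" by (simp add: x_def)
  ultimately show ?thesis by blast
qed

lemma card_fib_vpart_Suc_Suc:
  "card (fib_vpart (Suc m)) + fib m \<le> card (fib_vpart (Suc (Suc m)))"
proof -
  let ?P = "fib_vpart (Suc (Suc m))"
  let ?A = "{x \<in> ?P. x $ 0 = 0}" and ?B = "{x \<in> ?P. x $ 0 \<noteq> 0}"
  have fin: "finite ?A" "finite ?B" by (simp_all add: finite_fib_vpart)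
  have "card (fib_vpart (Suc m)) \<le> card ?A"
    by (rule card_inj_on_le[where f = "vCons 0"])
      (auto simp: inj_on_def vCons_0_in_fib_vpart fin)
  moreover have "fib m \<le> card ?B"
  proof -
    \<comment> \<open>For \<open>k < fib m\<close> the values \<open>fib m - k\<close> are nonzero
      and pairwise distinct, so vectors with these first entries lie in \<open>?B\<close> and differ
      from each other.\<close>
    have "(\<lambda>k. int (fib m - k)) ` {..<fib m} \<subseteq> (\<lambda>x. x $ 0) ` ?B"
    proof clarify
      fix k assume "k < fib m"
      moreover from fib_vpart_head_exists[OF this]
      obtain x where "x \<in> ?P" "x $ 0 = int (fib m - k)" by blast
      ultimately show "int (fib m - k) \<in> (\<lambda>x. x $ 0) ` ?B"
        by (intro image_eqI[of _ _ x]) auto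
    qed
    then have "card ((\<lambda>k. int (fib m - k)) ` {..<fib m}) \<le> card ?B"
      by (rule surj_card_le[OF fin(2)])
    moreover have "inj_on (\<lambda>k. int (fib m - k)) {..<fib m}" by (auto simp: inj_on_def)
    ultimately show ?thesis by (simp only: card_image card_lessThan)
  qed
  moreover have "card ?A + card ?B = card ?P"
    using fin by (subst card_Un_disjoint[symmetric]) (auto intro: arg_cong[of _ _ card])
  ultimately show ?thesis by linarith
qed

lemma fib_le_card_fib_vpart: "fib (Suc m) \<le> card (fib_vpart (Suc m))"
proof (induction m)
  case 0
  have "vec 1 (\<lambda>_. 1) \<in> fib_vpart 1" by (simp add: fib_vpart_iff)
  then show ?case
    using finite_fib_vpart[of 1] by (auto simp: Suc_le_eq card_gt_0_iff)
next
  case (Suc m)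
  then show ?case using card_fib_vpart_Suc_Suc[of m] by simp
qed

theorem theorem4p1:
  fixes n :: nat
  assumes "n \<ge> 3"
  shows "card (fib_vpart n) \<ge> fib n"
  using fib_le_card_fib_vpart[of "n - 1"] assms by simp

end
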